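(* Let $T\ge 1$, let $\mathbf{x}_1,\dots,\mathbf{x}_T$ be decision vectors, $B\in\mathbb{R}$, and for $t=1,\dots,T$ let the uncertain vector $\mathbf{d}_t$ reside in the polyhedral connected uncertainty set $$\mathcal{U}_t(\mathbf{d}_{t-1})=\{\mathbf{d}_t\mid \mathbf{G}_t\mathbf{d}_t\ge\mathbf{g}_t+\boldsymbol{\Delta}_t\mathbf{d}_{t-1}\},$$ where $\boldsymbol{\Delta}_1=\mathbf{0}$, so that $\mathcal{U}_1=\{\mathbf{d}_1\mid\mathbf{G}_1\mathbf{d}_1\ge\mathbf{g}_1\}$. Then the robust counterpart of the constraint $$\sum_{t=1}^T\mathbf{d}_t^\top\mathbf{x}_t\le B\quad\text{for all }\mathbf{d}_1\in\mathcal{U}_1\text{ and all }\mathbf{d}_t\in\mathcal{U}_t(\mathbf{d}_{t-1}),\ t=2,\dots,T,$$ is the following system in $\mathbf{x}_1,\dots,\mathbf{x}_T$ and auxiliary (dual) variables $\mathbf{q}_1,\dots,\mathbf{q}_T$ (that is, $\mathbf{x}_1,\dots,\mathbf{x}_T$ satisfy the constraint if and only if there exist $\mathbf{q}_1,\dots,\mathbf{q}_T$ satisfying the system): $$\sum_{t=1}^T\mathbf{q}_t^\top\mathbf{g}_t\le B,$$ $$\mathbf{q}_t^\top\mathbf{G}_t=\mathbf{x}_t^\top+\mathbf{q}_{t+1}^\top\boldsymbol{\Delta}_{t+1}\quad\text{for all }t=1,\dots,T,$$ $$\mathbf{q}_t\le 0\quad\text{for all }t=1,\dots,T,$$ where $\boldsymbol{\Delta}_1=\mathbf{0}$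 and $\boldsymbol{\Delta}_{T+1}=\mathbf{0}$ (so that the term $\mathbf{q}_{T+1}^\top\boldsymbol{\Delta}_{T+1}$ is zero).
   Context: All decisions $\mathbf{x}_t$ are here-and-now (they do not depend on the uncertainty), and $\mathbf{x}_t$ and $\mathbf{d}_t$ are real vectors of the same dimension. $\mathbf{G}_t$ and $\boldsymbol{\Delta}_t$ are constant real matrices and $\mathbf{g}_t$ constant real vectors of compatible dimensions, with one row per inequality describing $\mathcal{U}_t$; vector inequalities are componentwise; $\mathbf{q}_t$ has as many components as $\mathbf{g}_t$. The constraint under consideration, required to hold for all uncertainty realizations, is written in nested worst-case form as $\max_{\mathbf{d}_1\in\mathcal{U}_1}\{\mathbf{d}_1^\top\mathbf{x}_1+\max_{\mathbf{d}_2\in\mathcal{U}_2(\mathbf{d}_1)}\{\mathbf{d}_2^\top\mathbf{x}_2+\dots+\max_{\mathbf{d}_T\in\mathcal{U}_T(\mathbf{d}_{T-1})}\mathbf{d}_T^\top\mathbf{x}_T\}\}\le B$; its "robust counterpart" is an equivalent deterministic system of constraints.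
   Formalization: The formal theorem additionally assumes that at least one uncertainty realization (d_1,…,d_T) exists; without this the claim fails, e.g. T=1, G_1=[0], g_1=[1], x_1=[1], where the constraint is vacuous but the system is infeasible. *)

theory Defs
  imports Complex_Main "Jordan_Normal_Form.Matrix"
begin

text \<open>Vectors and matrices carry their dimensions as explicit numbers, so that these may differ
  from stage to stage. The order on vectors is componentwise.\<close>

definition uncertainty_set ::
  "real mat \<Rightarrow> real vec \<Rightarrow> real mat \<Rightarrow> real vec \<Rightarrow> real vec set" where
  "uncertainty_set G g \<Delta> d' = {d \<in> carrier_vec (dim_col G). G *\<^sub>v d \<ge> g + \<Delta> *\<^sub>v d'}"

text \<open>The entry \<open>d 0\<close> is a dummy of dimension \<open>n0\<close>: it only occurs multiplied by \<open>\<Delta> 1\<close>,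
  which is zero by convention. Entries beyond \<open>T\<close> are irrelevant.\<close>

definition realizations ::
  "nat \<Rightarrow> nat \<Rightarrow> (nat \<Rightarrow> real mat) \<Rightarrow> (nat \<Rightarrow> real vec) \<Rightarrow> (nat \<Rightarrow> real mat) \<Rightarrow> (nat \<Rightarrow> real vec) set"
where
  "realizations n0 T G g \<Delta> =
     {d. d 0 \<in> carrier_vec n0 \<and>
         (\<forall>t\<in>{1..T}. d t \<in> uncertainty_set (G t) (g t) (\<Delta> t) (d (t - 1)))}"

end

theory Submission
  imports Defs
begin

text \<open>The realizations, stacked into one vector, form a single polyhedron, so the theorem is
  linear programming duality, with the stagewise system being its dual written block by block.
  Sufficiency is a telescoping sum. Necessity is the affine Farkas lemma, which follows from the
  homogeneous one by adding a homogenizing coordinate; the homogeneous lemma is proved by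
  induction on the number of inequalities, projecting along a point at which the new inequality
  is needed.\<close>

section \<open>Farkas' lemma, homogeneous and affine\<close>

text \<open>When an inequality \<open>k\<close> is added, either the old ones still imply
  \<open>c\<close> and \<open>k\<close> gets multiplier 0, or some point satisfies the old ones and
  violates \<open>c\<close>. Composing all functionals with the projection along this point onto the
  kernel of \<open>a k\<close> eliminates \<open>k\<close>. The induction hypothesis then gives the
  other multipliers, and they determine that of \<open>k\<close>.\<close>

lemma farkas:
  fixes a :: "'i \<Rightarrow> 'j \<Rightarrow> real" and c :: "'j \<Rightarrow> real"
  assumes "finite I" and "finite J"
    and "\<And>z. (\<And>i. i \<in> I \<Longrightarrow> (\<Sum>j\<in>J. a i j * z j) \<le> 0) \<Longrightarrow> (\<Sum>j\<in>J. c j * z j) \<le> 0"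
  obtains y where "\<And>i. i \<in> I \<Longrightarrow> 0 \<le> y i" and "\<And>j. j \<in> J \<Longrightarrow> c j = (\<Sum>i\<in>I. y i * a i j)"
proof -
  have "\<exists>y. (\<forall>i\<in>I. 0 \<le> y i) \<and> (\<forall>j\<in>J. c j = (\<Sum>i\<in>I. y i * a i j))"
    using assms(1,3)
  proof (induction I arbitrary: a c rule: finite_induct)
    case empty
    \<comment> \<open>With no inequality to satisfy, every point is admissible; testing
      \<open>c\<close> on itself makes it vanish on \<open>J\<close>.\<close>
    have "(\<Sum>j\<in>J. c j * c j) \<le> 0" using empty.prems by simp
    moreover have "(\<Sum>j\<in>J. c j * c j) \<ge> 0" by (simp add: sum_nonneg)
    ultimately have "(\<Sum>j\<in>J. c j * c j) = 0" by linarith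
    then have "\<forall>j\<in>J. c j = 0" using assms(2) by (simp add: sum_nonneg_eq_0_iff)
    then show ?case by simp
  next
    case (insert k I)
    define L where "L f z = (\<Sum>j\<in>J. f j * z j)" for f z :: "'j \<Rightarrow> real"
    have L_diff_scale: "L (\<lambda>j. f j - r * h j) z = L f z - r * L h z"
      and L_diff_scale_right: "L f (\<lambda>j. z j - r * w j) = L f z - r * L f w" for f h z w r
      by (simp_all add: L_def algebra_simps sum_subtractf sum_distrib_left)
    have L_scale: "L f (\<lambda>j. r * z j) = r * L f z" for f z r
      by (simp add: L_def algebra_simps sum_distrib_left)
    have imp: "L c z \<le> 0" if "\<And>i. i \<in> insert k I \<Longrightarrow> L (a i) z \<le> 0" for z
      using insert.prems[of z] that by (simp add: L_def)
    show ?case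
    proof (cases "\<forall>z. (\<forall>i\<in>I. L (a i) z \<le> 0) \<longrightarrow> L c z \<le> 0")
      case True
      then obtain y where "\<forall>i\<in>I. 0 \<le> y i" "\<forall>j\<in>J. c j = (\<Sum>i\<in>I. y i * a i j)"
        using insert.IH[of a c] by (auto simp: L_def)
      then show ?thesis using insert.hyps
        by (intro exI[of _ "y(k := 0)"]) (auto simp: fun_upd_def if_distrib cong: if_cong intro!: sum.cong)
    next
      case False
      then obtain w where w: "\<And>i. i \<in> I \<Longrightarrow> L (a i) w \<le> 0" "L c w > 0" by force
      \<comment> \<open>Otherwise \<open>w\<close> would satisfy all inequalities, and
        \<open>imp\<close> would contradict \<open>L c w > 0\<close>.\<close>
      then have akw: "L (a k) w > 0" using imp[of w] by fastforce
      define p where "p j = w j / L (a k) w" for j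
      have Lp: "L f p = L f w / L (a k) w" for f
        using L_scale[of f "1 / L (a k) w" w] by (simp add: p_def[abs_def])
      have p: "L (a k) p = 1" "\<And>i. i \<in> I \<Longrightarrow> L (a i) p \<le> 0" "L c p > 0"
        using akw w by (auto simp: Lp divide_nonpos_pos)
      \<comment> \<open>Since \<open>a k\<close> has value 1 at \<open>p\<close>, the map sending
        \<open>z\<close> to \<open>z - L (a k) z * p\<close> is a projection onto the kernel of
        \<open>a k\<close>. The functionals \<open>a'\<close> and \<open>c'\<close> are
        \<open>a\<close> and \<open>c\<close> composed with it.\<close>
      define a' where "a' i j = a i j - L (a i) p * a k j" for i j
      define c' where "c' j = c j - L c p * a k j" for j
      have "L c' z \<le> 0" if z: "\<And>i. i \<in> I \<Longrightarrow> L (a' i) z \<le> 0" for z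
      proof -
        \<comment> \<open>At the projected point \<open>a k\<close> is 0, so the inequality
          \<open>k\<close> holds there and \<open>imp\<close> applies.\<close>
        let ?z = "\<lambda>j. z j - L (a k) z * p j"
        have "L (a i) ?z \<le> 0" if "i \<in> insert k I" for i
          using that p(1) z[of i] unfolding a'_def L_diff_scale_right L_diff_scale
          by (auto simp: algebra_simps)
        from imp[OF this] show ?thesis
          unfolding c'_def L_diff_scale_right L_diff_scale by (simp add: algebra_simps)
      qed
      then obtain y where y: "\<forall>i\<in>I. 0 \<le> y i" "\<forall>j\<in>J. c' j = (\<Sum>i\<in>I. y i * a' i j)"
        using insert.IH[of a' c'] by (auto simp: L_def)
      \<comment> \<open>Expanding \<open>a'\<close> and \<open>c'\<close> in the representation of
        \<open>c'\<close> leaves this coefficient at \<open>a k\<close>. It is nonnegative because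
        \<open>p\<close> has a positive value under \<open>c\<close> and nonpositive values under
        the old \<open>a i\<close>.\<close>
      let ?r = "L c p - (\<Sum>i\<in>I. y i * L (a i) p)"
      let ?y = "y(k := ?r)"
      have "(\<Sum>i\<in>I. y i * L (a i) p) \<le> 0"
        using y(1) p(2) by (intro sum_nonpos) (simp add: mult_nonneg_nonpos)
      then have "\<forall>i\<in>insert k I. 0 \<le> ?y i" using y(1) p(3) by auto
      moreover have "c j = (\<Sum>i\<in>insert k I. ?y i * a i j)" if "j \<in> J" for j
      proof -
        have "c j - L c p * a k j = (\<Sum>i\<in>I. y i * (a i j - L (a i) p * a k j))"
          using y(2) that by (simp add: c'_def a'_def)
        also have "\<dots> = (\<Sum>i\<in>I. y i * a i j) - (\<Sum>i\<in>I. y i * L (a i) p) * a k j"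
          by (simp add: algebra_simps sum_subtractf sum_distrib_left)
        finally have "c j = ?r * a k j + (\<Sum>i\<in>I. y i * a i j)" by (simp add: algebra_simps)
        moreover have "(\<Sum>i\<in>I. ?y i * a i j) = (\<Sum>i\<in>I. y i * a i j)"
          using insert.hyps by (intro sum.cong) auto
        ultimately show ?thesis using insert.hyps by simp
      qed
      ultimately show ?thesis by blast
    qed
  qed
  then show thesis using that by blast
qed

text \<open>With a scale \<open>s \<ge> 0\<close> as an extra variable the implication becomes
  homogeneous. For \<open>s > 0\<close> it is a rescaling of the given one. For \<open>s = 0\<close>
  it concerns recession directions, and these are controlled by moving away from the feasible point
  \<open>z0\<close>.\<close>

lemma affine_farkas:
  fixes a :: "'i \<Rightarrow> 'j \<Rightarrow> real" and b :: "'i \<Rightarrow> real" and c :: "'j \<Rightarrow> real"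
  assumes I: "finite I" and J: "finite J"
    and feasible: "\<And>i. i \<in> I \<Longrightarrow> (\<Sum>j\<in>J. a i j * z0 j) \<le> b i"
    and bounded: "\<And>z. (\<And>i. i \<in> I \<Longrightarrow> (\<Sum>j\<in>J. a i j * z j) \<le> b i) \<Longrightarrow> (\<Sum>j\<in>J. c j * z j) \<le> B"
  shows "\<exists>y. (\<forall>i\<in>I. 0 \<le> y i) \<and> (\<forall>j\<in>J. c j = (\<Sum>i\<in>I. y i * a i j)) \<and> (\<Sum>i\<in>I. y i * b i) \<le> B"
proof -
  define L where "L f z = (\<Sum>j\<in>J. f j * z j)" for f z :: "'j \<Rightarrow> real"
  have L_add_scale: "L f (\<lambda>j. z j + r * w j) = L f z + r * L f w" for f z w r
    by (simp add: L_def algebra_simps sum.distrib sum_distrib_left)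
  have L_divide: "L f (\<lambda>j. z j / s) = L f z / s" for f z s
    by (simp add: L_def sum_divide_distrib)
  have bound: "L c z \<le> B" if "\<And>i. i \<in> I \<Longrightarrow> L (a i) z \<le> b i" for z
    using bounded[of z] that by (simp add: L_def)
  have homogeneous: "L c z \<le> B * s" if s: "s \<ge> 0" and z: "\<And>i. i \<in> I \<Longrightarrow> L (a i) z \<le> b i * s" for z s
  proof (cases "s = 0")
    case False
    with s have "s > 0" by simp
    with bound[of "\<lambda>j. z j / s"] z show ?thesis by (simp add: L_divide pos_divide_le_eq)
  next
    case True
    have growth: "L c z0 + r * L c z \<le> B" if "r \<ge> 0" for r
    proof -
      have "L (a i) z0 + r * L (a i) z \<le> b i" if "i \<in> I" for i
        using feasible[OF that] z[OF that] \<open>r \<ge> 0\<close> True mult_nonneg_nonpos[of r "L (a i) z"]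
        by (simp add: L_def)
      then show ?thesis using bound[of "\<lambda>j. z0 j + r * z j"] by (simp add: L_add_scale)
    qed
    have "L c z \<le> 0"
    proof (rule ccontr)
      assume "\<not> L c z \<le> 0"
      then have pos: "L c z > 0" by simp
      have "L c z0 \<le> B" using growth[of 0] by simp
      \<comment> \<open>The step length raises the value to exactly \<open>B + 1\<close>; it is
        nonnegative because \<open>L c z0 \<le> B\<close>.\<close>
      then have "L c z0 + (B - L c z0 + 1) / L c z * L c z \<le> B"
        using pos by (intro growth) simp
      with pos show False by simp
    qed
    with True show ?thesis by simp
  qed
  \<comment> \<open>As a variable, \<open>None\<close> is the scale \<open>s\<close>; as a row, it
    is the inequality \<open>- s \<le> 0\<close>. The other rows and the objective absorb their
    right-hand sides as coefficients of \<open>s\<close>.\<close>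
  define a' where "a' i j = (case i of None \<Rightarrow> (case j of None \<Rightarrow> -1 | Some j \<Rightarrow> 0)
    | Some i \<Rightarrow> (case j of None \<Rightarrow> - b i | Some j \<Rightarrow> a i j))" for i :: "'i option" and j :: "'j option"
  define c' where "c' j = (case j of None \<Rightarrow> - B | Some j \<Rightarrow> c j)" for j
  let ?I = "insert None (Some ` I)" and ?J = "insert None (Some ` J)"
  have "(\<Sum>j\<in>?J. c' j * z j) \<le> 0" if z: "\<And>i. i \<in> ?I \<Longrightarrow> (\<Sum>j\<in>?J. a' i j * z j) \<le> 0" for z
  proof -
    have "z None \<ge> 0" using z[of None] J by (simp add: sum.reindex a'_def)
    moreover have "L (a i) (\<lambda>j. z (Some j)) \<le> b i * z None" if "i \<in> I" for i
      using z[of "Some i"] that J by (simp add: sum.reindex a'_def L_def)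
    ultimately have "L c (\<lambda>j. z (Some j)) \<le> B * z None" by (rule homogeneous)
    then show ?thesis using J by (simp add: sum.reindex c'_def L_def)
  qed
  then obtain y where y: "\<And>i. i \<in> ?I \<Longrightarrow> 0 \<le> y i"
    and eq: "\<And>j. j \<in> ?J \<Longrightarrow> c' j = (\<Sum>i\<in>?I. y i * a' i j)"
    using farkas[of ?I ?J a' c'] I J by auto
  show ?thesis
  proof (intro exI[of _ "\<lambda>i. y (Some i)"] conjI ballI)
    show "0 \<le> y (Some i)" if "i \<in> I" for i using y that by simp
    show "c j = (\<Sum>i\<in>I. y (Some i) * a i j)" if "j \<in> J" for j
      using eq[of "Some j"] that I by (simp add: sum.reindex a'_def c'_def)
    \<comment> \<open>The column of \<open>None\<close> says that this sum equals
      \<open>B - y None\<close>, with \<open>y None\<close> nonnegative.\<close>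
    show "(\<Sum>i\<in>I. y (Some i) * b i) \<le> B"
      using eq[of None] y[of None] I by (simp add: sum.reindex a'_def c'_def sum_negf)
  qed
qed

section \<open>Componentwise inequalities and adjoint matrices\<close>

lemma mem_uncertainty_set_iff:
  assumes "G \<in> carrier_mat m n" and "g \<in> carrier_vec m" and "\<Delta> \<in> carrier_mat m n'"
    and "d' \<in> carrier_vec n'"
  shows "d \<in> uncertainty_set G g \<Delta> d' \<longleftrightarrow> d \<in> carrier_vec n \<and>
    (\<forall>i<m. (\<Sum>j<n. G $$ (i, j) * d $ j) \<ge> g $ i + (\<Sum>j<n'. \<Delta> $$ (i, j) * d' $ j))"
  using assms
  by (auto simp: uncertainty_set_def less_eq_vec_def scalar_prod_def atLeast0LessThan)

lemma scalar_prod_mono_nonpos: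
  fixes u v q :: "real vec"
  assumes "u \<ge> v" and "q \<le> 0\<^sub>v k" and "v \<in> carrier_vec k"
  shows "u \<bullet> q \<le> v \<bullet> q"
  using assms by (auto simp: less_eq_vec_def scalar_prod_def intro!: sum_mono mult_right_mono_neg)

text \<open>Exchanging two finite sums moves the matrix to the other factor. This is how the stage
  equations, written with transposes, are paired with a realization.\<close>

lemma transpose_mult_scalar_prod:
  fixes A :: "real mat"
  assumes "A \<in> carrier_mat k l" and "d \<in> carrier_vec l" and "q \<in> carrier_vec k"
  shows "d \<bullet> (transpose_mat A *\<^sub>v q) = (A *\<^sub>v d) \<bullet> q"
proof -
  have "d \<bullet> (transpose_mat A *\<^sub>v q) = (\<Sum>j<l. \<Sum>i<k. d $ j * (A $$ (i, j) * q $ i))"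
    using assms by (auto simp: scalar_prod_def atLeast0LessThan sum_distrib_left)
  also have "\<dots> = (\<Sum>i<k. \<Sum>j<l. d $ j * (A $$ (i, j) * q $ i))" by (rule sum.swap)
  also have "\<dots> = (A *\<^sub>v d) \<bullet> q"
    using assms by (auto simp: scalar_prod_def atLeast0LessThan sum_distrib_left mult_ac)
  finally show ?thesis .
qed

text \<open>Row equations of the system appear transposed, as equations of column vectors.
  Non-emptiness of the realizations is assumed because over an empty set the constraint holds
  vacuously, while the dual system may have no solution. The vector \<open>q (T + 1)\<close> gives
  the last equation a well-formed right-hand side and is annihilated by
  \<open>\<Delta> (T + 1)\<close>.\<close>

theorem theorem3:
  fixes T :: nat and n m :: "nat \<Rightarrow> nat"
    and G \<Delta> :: "nat \<Rightarrow> real mat" and g x :: "nat \<Rightarrow> real vec" and B :: real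
  assumes "T \<ge> 1"
    and "\<And>t. t \<in> {1..T} \<Longrightarrow> G t \<in> carrier_mat (m t) (n t)"
    and "\<And>t. t \<in> {1..T} \<Longrightarrow> g t \<in> carrier_vec (m t)"
    and "\<And>t. t \<in> {1..T} \<Longrightarrow> x t \<in> carrier_vec (n t)"
    and "\<And>t. t \<in> {2..T} \<Longrightarrow> \<Delta> t \<in> carrier_mat (m t) (n (t - 1))"
    and "\<Delta> 1 = 0\<^sub>m (m 1) (n 0)"
    and "\<Delta> (T + 1) = 0\<^sub>m (m (T + 1)) (n T)"
    and "realizations (n 0) T G g \<Delta> \<noteq> {}"
  shows "(\<forall>d \<in> realizations (n 0) T G g \<Delta>. (\<Sum>t = 1..T. d t \<bullet> x t) \<le> B) \<longleftrightarrow>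
    (\<exists>q :: nat \<Rightarrow> real vec.
        (\<forall>t\<in>{1..T + 1}. q t \<in> carrier_vec (m t)) \<and>
        (\<Sum>t = 1..T. q t \<bullet> g t) \<le> B \<and>
        (\<forall>t\<in>{1..T}. transpose_mat (G t) *\<^sub>v q t = x t + transpose_mat (\<Delta> (t + 1)) *\<^sub>v q (t + 1)) \<and>
        (\<forall>t\<in>{1..T}. q t \<le> 0\<^sub>v (m t)))"
proof -

  \<comment> \<open>Dimensions and scalar form of the realizations\<close>
  note T = assms(1) and G = assms(2) and g = assms(3) and x = assms(4) and \<Delta>_zero = assms(6,7)
  \<comment> \<open>The zero matrices at stages \<open>1\<close> and \<open>T + 1\<close> also have
    the generic dimensions, so all stages can be treated alike.\<close>
  have \<Delta>: "\<Delta> t \<in> carrier_mat (m t) (n (t - 1))" if t: "t \<in> {1..T + 1}" for t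
  proof -
    consider "t = 1" | "t = T + 1" | "t \<in> {2..T}" using t by fastforce
    then show ?thesis using assms(5) \<Delta>_zero by cases auto
  qed
  have realizations_carrier: "d t \<in> carrier_vec (n t)"
    if "d \<in> realizations (n 0) T G g \<Delta>" "t \<le> T" for d t
  proof (cases "t = 0")
    case True
    with that show ?thesis by (simp add: realizations_def)
  next
    case False
    with that have "t \<in> {1..T}" by simp
    with that(1) have "d t \<in> uncertainty_set (G t) (g t) (\<Delta> t) (d (t - 1))"
      unfolding realizations_def by blast
    with G[OF \<open>t \<in> {1..T}\<close>] show ?thesis by (simp add: uncertainty_set_def)
  qed
  have realizations_iff: "d \<in> realizations (n 0) T G g \<Delta> \<longleftrightarrow> (\<forall>t\<le>T. d t \<in> carrier_vec (n t)) \<and>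
    (\<forall>t\<in>{1..T}. \<forall>i<m t. g t $ i + (\<Sum>j<n (t - 1). \<Delta> t $$ (i, j) * d (t - 1) $ j)
        \<le> (\<Sum>j<n t. G t $$ (i, j) * d t $ j))" (is "_ = (?C \<and> ?R)") for d
  proof (cases ?C)
    case True
    then have "d t \<in> uncertainty_set (G t) (g t) (\<Delta> t) (d (t - 1)) \<longleftrightarrow>
      (\<forall>i<m t. g t $ i + (\<Sum>j<n (t - 1). \<Delta> t $$ (i, j) * d (t - 1) $ j)
        \<le> (\<Sum>j<n t. G t $$ (i, j) * d t $ j))" if "t \<in> {1..T}" for t
      using that by (subst mem_uncertainty_set_iff[OF G g \<Delta>]) auto
    with True show ?thesis by (simp add: realizations_def)
  next
    case False
    then show ?thesis using realizations_carrier by blast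
  qed
  show ?thesis
  proof

    \<comment> \<open>Sufficiency: weak duality by telescoping\<close>
    assume "\<exists>q :: nat \<Rightarrow> real vec.
        (\<forall>t\<in>{1..T + 1}. q t \<in> carrier_vec (m t)) \<and>
        (\<Sum>t = 1..T. q t \<bullet> g t) \<le> B \<and>
        (\<forall>t\<in>{1..T}. transpose_mat (G t) *\<^sub>v q t = x t + transpose_mat (\<Delta> (t + 1)) *\<^sub>v q (t + 1)) \<and>
        (\<forall>t\<in>{1..T}. q t \<le> 0\<^sub>v (m t))"
    then obtain q where q: "\<And>t. t \<in> {1..T + 1} \<Longrightarrow> q t \<in> carrier_vec (m t)"
      and qB: "(\<Sum>t = 1..T. q t \<bullet> g t) \<le> B"
      and dual: "\<And>t. t \<in> {1..T} \<Longrightarrow>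
        transpose_mat (G t) *\<^sub>v q t = x t + transpose_mat (\<Delta> (t + 1)) *\<^sub>v q (t + 1)"
      and nonpos: "\<And>t. t \<in> {1..T} \<Longrightarrow> q t \<le> 0\<^sub>v (m t)"
      by blast
    show "\<forall>d\<in>realizations (n 0) T G g \<Delta>. (\<Sum>t = 1..T. d t \<bullet> x t) \<le> B"
    proof
      fix d assume d: "d \<in> realizations (n 0) T G g \<Delta>"
      \<comment> \<open>The coupling between stages \<open>t - 1\<close> and \<open>t\<close>,
        weighted by the dual vector of stage \<open>t\<close>. Pairing the equation of stage
        \<open>t\<close> with \<open>d t\<close> produces \<open>h (Suc t)\<close>, and multiplying
        the primal inequality of stage \<open>t\<close> by \<open>q t\<close> produces
        \<open>h t\<close>.\<close>
      define h where "h t = (\<Delta> t *\<^sub>v d (t - 1)) \<bullet> q t" for t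
      have step: "d t \<bullet> x t \<le> q t \<bullet> g t + (h t - h (Suc t))" if t: "t \<in> {1..T}" for t
      proof -
        have dt: "d t \<in> carrier_vec (n t)" and dt': "d (t - 1) \<in> carrier_vec (n (t - 1))"
          using realizations_carrier[OF d] t by auto
        have G': "G t \<in> carrier_mat (m t) (n t)" and g': "g t \<in> carrier_vec (m t)"
          and x': "x t \<in> carrier_vec (n t)" and \<Delta>': "\<Delta> t \<in> carrier_mat (m t) (n (t - 1))"
          and \<Delta>'': "\<Delta> (t + 1) \<in> carrier_mat (m (t + 1)) (n t)"
          and q': "q t \<in> carrier_vec (m t)" and q'': "q (t + 1) \<in> carrier_vec (m (t + 1))"
          using G[of t] g[of t] x[of t] \<Delta>[of t] \<Delta>[of "t + 1"] q[of t] q[of "t + 1"] t by auto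
        have "(G t *\<^sub>v d t) \<bullet> q t = d t \<bullet> (x t + transpose_mat (\<Delta> (t + 1)) *\<^sub>v q (t + 1))"
          using transpose_mult_scalar_prod[OF G' dt q'] dual[OF t] by simp
        also have "\<dots> = d t \<bullet> x t + d t \<bullet> (transpose_mat (\<Delta> (t + 1)) *\<^sub>v q (t + 1))"
          using \<Delta>'' q'' by (intro scalar_prod_add_distrib[OF dt x']) simp
        also have "\<dots> = d t \<bullet> x t + h (Suc t)"
          using transpose_mult_scalar_prod[OF \<Delta>'' dt q''] by (simp add: h_def)
        finally have eq: "(G t *\<^sub>v d t) \<bullet> q t = d t \<bullet> x t + h (Suc t)" .
        have "G t *\<^sub>v d t \<ge> g t + \<Delta> t *\<^sub>v d (t - 1)"
          using d t by (auto simp: realizations_def uncertainty_set_def)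
        then have "(G t *\<^sub>v d t) \<bullet> q t \<le> (g t + \<Delta> t *\<^sub>v d (t - 1)) \<bullet> q t"
          using g' \<Delta>' dt' by (intro scalar_prod_mono_nonpos[OF _ nonpos[OF t]]) auto
        also have "\<dots> = g t \<bullet> q t + h t"
          unfolding h_def using \<Delta>' dt' q' g'
          by (intro add_scalar_prod_distrib[of _ "m t"]) auto
        also have "g t \<bullet> q t = q t \<bullet> g t" using comm_scalar_prod[OF g' q'] .
        finally show ?thesis using eq by simp
      qed
      \<comment> \<open>The telescoping sum leaves only these two boundary terms; the zero matrices
        at both ends remove them.\<close>
      have h_zero: "h 1 = 0" "h (Suc T) = 0"
        using \<Delta>_zero realizations_carrier[OF d, of 0] realizations_carrier[OF d, of T]
          q[of 1] q[of "Suc T"] by (auto simp: h_def scalar_prod_def)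
      have "(\<Sum>t = 1..T. d t \<bullet> x t) \<le> (\<Sum>t = 1..T. q t \<bullet> g t + (h t - h (Suc t)))"
        by (rule sum_mono) (rule step)
      also have "\<dots> = (\<Sum>t = 1..T. q t \<bullet> g t) - (\<Sum>t = 1..T. h (Suc t) - h t)"
        by (simp add: sum.distrib sum_subtractf)
      also have "(\<Sum>t = 1..T. h (Suc t) - h t) = 0"
        using T h_zero by (simp add: sum_Suc_diff)
      finally show "(\<Sum>t = 1..T. d t \<bullet> x t) \<le> B" using qB by simp
    qed
  next

    \<comment> \<open>Necessity: Farkas' lemma for the stacked system\<close>
    assume primal: "\<forall>d\<in>realizations (n 0) T G g \<Delta>. (\<Sum>t = 1..T. d t \<bullet> x t) \<le> B"
    let ?I = "Sigma {1..T} (\<lambda>t. {..<m t})" and ?J = "Sigma {1..T} (\<lambda>t. {..<n t})"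
    \<comment> \<open>Row block \<open>t\<close> encodes \<open>\<Delta> t *\<^sub>v d (t - 1) - G t
      *\<^sub>v d t \<le> - g t\<close>. The stacked variables start at stage 1, so for
      \<open>t = 1\<close> the \<open>\<Delta>\<close> part meets no column.\<close>
    define a where "a = (\<lambda>(t, i) (s, j). (if s = t - 1 then \<Delta> t $$ (i, j) else 0)
      - (if s = t then G t $$ (i, j) else 0))"
    define b where "b = (\<lambda>(t, i). - (g t $ i))"
    define c where "c = (\<lambda>(t, j). x t $ j)"
    have sum_I: "(\<Sum>k\<in>?I. f k) = (\<Sum>t = 1..T. \<Sum>i<m t. f (t, i))"
      and sum_J: "(\<Sum>k\<in>?J. f k) = (\<Sum>t = 1..T. \<Sum>j<n t. f (t, j))" for f :: "nat \<times> nat \<Rightarrow> real"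
      by (simp_all add: sum.Sigma)
    have row: "(\<Sum>k\<in>?J. a (t, i) k * z k)
        = (\<Sum>j<n (t - 1). \<Delta> t $$ (i, j) * (if t = 1 then 0 else z (t - 1, j)))
          - (\<Sum>j<n t. G t $$ (i, j) * z (t, j))"
      if "t \<in> {1..T}" "i < m t" for t i z
    proof -
      have "(\<Sum>k\<in>?J. a (t, i) k * z k)
        = (\<Sum>s = 1..T. (if s = t - 1 then \<Sum>j<n s. \<Delta> t $$ (i, j) * z (s, j) else 0)
          - (if s = t then \<Sum>j<n s. G t $$ (i, j) * z (s, j) else 0))"
        unfolding sum_J by (intro sum.cong) (auto simp: a_def sum_subtractf left_diff_distrib sum_negf)
      also have "\<dots> = (if t = 1 then 0 else \<Sum>j<n (t - 1). \<Delta> t $$ (i, j) * z (t - 1, j))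
          - (\<Sum>j<n t. G t $$ (i, j) * z (t, j))"
        using that by (auto simp: sum_subtractf)
      finally show ?thesis by simp
    qed
    \<comment> \<open>Since \<open>\<Delta> 1 = 0\<close>, the dummy entry \<open>d 0\<close> has no effect.\<close>
    have row_le_iff: "(\<Sum>k\<in>?J. a (t, i) k * z k) \<le> b (t, i) \<longleftrightarrow>
        g t $ i + (\<Sum>j<n (t - 1). \<Delta> t $$ (i, j) * d (t - 1) $ j) \<le> (\<Sum>j<n t. G t $$ (i, j) * d t $ j)"
      if "t \<in> {1..T}" "i < m t" and z: "\<And>s j. s \<in> {1..T} \<Longrightarrow> j < n s \<Longrightarrow> d s $ j = z (s, j)" for t i z d
    proof -
      have "(\<Sum>j<n (t - 1). \<Delta> t $$ (i, j) * (if t = 1 then 0 else z (t - 1, j)))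
        = (\<Sum>j<n (t - 1). \<Delta> t $$ (i, j) * d (t - 1) $ j)"
      proof (cases "t = 1")
        case True
        then show ?thesis using \<Delta>_zero that(2) by simp
      next
        case False
        then have "t - 1 \<in> {1..T}" using that(1) by auto
        then have "(if t = 1 then 0 else z (t - 1, j)) = d (t - 1) $ j" if "j < n (t - 1)" for j
          using z[of "t - 1" j] False that by simp
        then show ?thesis by simp
      qed
      moreover have "(\<Sum>j<n t. G t $$ (i, j) * z (t, j)) = (\<Sum>j<n t. G t $$ (i, j) * d t $ j)"
        using that by (intro sum.cong) auto
      ultimately show ?thesis using row[OF that(1,2)] by (auto simp: b_def)
    qed
    obtain d0 where d0: "d0 \<in> realizations (n 0) T G g \<Delta>" using assms(8) by blast
    define z0 where "z0 = (\<lambda>(t, j). d0 t $ j)"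
    have feasible: "(\<Sum>k\<in>?J. a r k * z0 k) \<le> b r" if "r \<in> ?I" for r
      using that d0 row_le_iff[of "fst r" "snd r" d0 z0] by (auto simp: realizations_iff z0_def)
    have bounded: "(\<Sum>k\<in>?J. c k * z k) \<le> B" if z: "\<And>r. r \<in> ?I \<Longrightarrow> (\<Sum>k\<in>?J. a r k * z k) \<le> b r" for z
    proof -
      \<comment> \<open>The entry \<open>d 0\<close> takes whatever values \<open>z\<close> has at
        stage 0, outside the stacked variables. Only its dimension matters, since
        \<open>\<Delta> 1\<close> is zero.\<close>
      define d where "d t = vec (n t) (\<lambda>j. z (t, j))" for t
      have "d \<in> realizations (n 0) T G g \<Delta>"
        unfolding realizations_iff
      proof (intro conjI ballI allI impI)
        show "d t \<in> carrier_vec (n t)" for t by (simp add: d_def)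
        show "g t $ i + (\<Sum>j<n (t - 1). \<Delta> t $$ (i, j) * d (t - 1) $ j)
          \<le> (\<Sum>j<n t. G t $$ (i, j) * d t $ j)" if "t \<in> {1..T}" "i < m t" for t i
          using z[of "(t, i)"] that by (subst row_le_iff[of t i d z, symmetric]) (auto simp: d_def)
      qed
      then have "(\<Sum>t = 1..T. d t \<bullet> x t) \<le> B" using primal by blast
      moreover have "d t \<bullet> x t = (\<Sum>j<n t. c (t, j) * z (t, j))" if "t \<in> {1..T}" for t
        using carrier_vecD[OF x[OF that]]
        by (simp add: scalar_prod_def d_def c_def atLeast0LessThan mult.commute)
      then have "(\<Sum>t = 1..T. d t \<bullet> x t) = (\<Sum>k\<in>?J. c k * z k)"
        unfolding sum_J by (rule sum.cong[OF refl])
      ultimately show ?thesis by simp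
    qed
    have fin: "finite ?I" "finite ?J" by auto
    have "\<exists>y. (\<forall>r\<in>?I. 0 \<le> y r) \<and> (\<forall>k\<in>?J. c k = (\<Sum>r\<in>?I. y r * a r k)) \<and> (\<Sum>r\<in>?I. y r * b r) \<le> B"
      by (rule affine_farkas[of ?I ?J a z0 b c B, OF fin]) (erule feasible, rule bounded, blast)
    then obtain y where y: "\<forall>r\<in>?I. 0 \<le> y r"
      and col: "\<forall>k\<in>?J. c k = (\<Sum>r\<in>?I. y r * a r k)"
      and yB: "(\<Sum>r\<in>?I. y r * b r) \<le> B"
      by (elim exE conjE) (rule that)
    \<comment> \<open>The rows were negated to turn \<open>\<ge>\<close> into \<open>\<le>\<close>,
      hence the sign change from multipliers to dual vectors. Outside the stages the value is zero,
      in particular at \<open>T + 1\<close>.\<close>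
    define q where "q t = (if t \<in> {1..T} then vec (m t) (\<lambda>i. - y (t, i)) else 0\<^sub>v (m t))" for t
    \<comment> \<open>Column block \<open>s\<close> of the stacked matrix meets just two row blocks:
      \<open>G s\<close> in block \<open>s\<close>, and \<open>\<Delta> (s + 1)\<close> in block
      \<open>s + 1\<close> if that stage exists. Its column identity is thus the stage
      equation.\<close>
    have col_sum: "x s $ j = (\<Sum>i<m s. G s $$ (i, j) * q s $ i)
        - (\<Sum>i<m (s + 1). \<Delta> (s + 1) $$ (i, j) * q (s + 1) $ i)"
      if s: "s \<in> {1..T}" "j < n s" for s j
    proof -
      have "x s $ j = (\<Sum>t = 1..T. \<Sum>i<m t. y (t, i) * a (t, i) (s, j))"
        using bspec[OF col, of "(s, j)"] s unfolding sum_I by (simp add: c_def)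
      also have "\<dots> = (\<Sum>t = 1..T. (if t = s then \<Sum>i<m t. G t $$ (i, j) * q t $ i else 0)
          - (if t = s + 1 then \<Sum>i<m t. \<Delta> t $$ (i, j) * q t $ i else 0))"
      proof (rule sum.cong[OF refl])
        fix t assume "t \<in> {1..T}"
        \<comment> \<open>Because \<open>s \<ge> 1\<close>, the truncated condition
          \<open>s = t - 1\<close> is equivalent to \<open>t = s + 1\<close>.\<close>
        then have "y (t, i) * a (t, i) (s, j) = (if t = s then G t $$ (i, j) * q t $ i else 0)
            - (if t = s + 1 then \<Delta> t $$ (i, j) * q t $ i else 0)" if "i < m t" for i
          using that s(1) by (auto simp: a_def q_def)
        then have "(\<Sum>i<m t. y (t, i) * a (t, i) (s, j))
            = (\<Sum>i<m t. (if t = s then G t $$ (i, j) * q t $ i else 0)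
              - (if t = s + 1 then \<Delta> t $$ (i, j) * q t $ i else 0))"
          by (intro sum.cong) auto
        then show "(\<Sum>i<m t. y (t, i) * a (t, i) (s, j))
            = (if t = s then \<Sum>i<m t. G t $$ (i, j) * q t $ i else 0)
              - (if t = s + 1 then \<Sum>i<m t. \<Delta> t $$ (i, j) * q t $ i else 0)"
          by (simp add: sum_subtractf)
      qed
      also have "\<dots> = (\<Sum>i<m s. G s $$ (i, j) * q s $ i)
          - (if s + 1 \<le> T then \<Sum>i<m (s + 1). \<Delta> (s + 1) $$ (i, j) * q (s + 1) $ i else 0)"
        using s by (auto simp: sum_subtractf)
      \<comment> \<open>For \<open>s = T\<close> there is no next row block; the sum on the right is
        still 0 because \<open>q (T + 1)\<close> was set to zero.\<close>
      also have "(if s + 1 \<le> T then \<Sum>i<m (s + 1). \<Delta> (s + 1) $$ (i, j) * q (s + 1) $ i else 0)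
          = (\<Sum>i<m (s + 1). \<Delta> (s + 1) $$ (i, j) * q (s + 1) $ i)"
        using s by (auto simp: q_def)
      finally show ?thesis .
    qed
    show "\<exists>q :: nat \<Rightarrow> real vec.
        (\<forall>t\<in>{1..T + 1}. q t \<in> carrier_vec (m t)) \<and>
        (\<Sum>t = 1..T. q t \<bullet> g t) \<le> B \<and>
        (\<forall>t\<in>{1..T}. transpose_mat (G t) *\<^sub>v q t = x t + transpose_mat (\<Delta> (t + 1)) *\<^sub>v q (t + 1)) \<and>
        (\<forall>t\<in>{1..T}. q t \<le> 0\<^sub>v (m t))"
    proof (intro exI conjI ballI)
      show q: "q t \<in> carrier_vec (m t)" for t by (simp add: q_def)
      have "q t \<bullet> g t = (\<Sum>i<m t. y (t, i) * b (t, i))" if "t \<in> {1..T}" for t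
        using carrier_vecD[OF g[OF that]] that
        by (simp add: scalar_prod_def q_def b_def atLeast0LessThan)
      then have "(\<Sum>t = 1..T. q t \<bullet> g t) = (\<Sum>r\<in>?I. y r * b r)"
        unfolding sum_I by (rule sum.cong[OF refl])
      with yB show "(\<Sum>t = 1..T. q t \<bullet> g t) \<le> B" by simp
      show "q t \<le> 0\<^sub>v (m t)" if "t \<in> {1..T}" for t
        using y that by (auto simp: q_def less_eq_vec_def)
      show "transpose_mat (G t) *\<^sub>v q t = x t + transpose_mat (\<Delta> (t + 1)) *\<^sub>v q (t + 1)"
        if t: "t \<in> {1..T}" for t
      proof (rule eq_vecI)
        have *: "G t \<in> carrier_mat (m t) (n t)" "\<Delta> (t + 1) \<in> carrier_mat (m (t + 1)) (n t)"
          "x t \<in> carrier_vec (n t)" "q t \<in> carrier_vec (m t)" "q (t + 1) \<in> carrier_vec (m (t + 1))"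
          using G[of t] \<Delta>[of "t + 1"] x[of t] q t by auto
        then show "dim_vec (transpose_mat (G t) *\<^sub>v q t)
            = dim_vec (x t + transpose_mat (\<Delta> (t + 1)) *\<^sub>v q (t + 1))" by auto
        fix j assume "j < dim_vec (x t + transpose_mat (\<Delta> (t + 1)) *\<^sub>v q (t + 1))"
        then have "j < n t" using * by auto
        then show "(transpose_mat (G t) *\<^sub>v q t) $ j
            = (x t + transpose_mat (\<Delta> (t + 1)) *\<^sub>v q (t + 1)) $ j"
          using col_sum[OF t, of j] * by (auto simp: scalar_prod_def atLeast0LessThan)
      qed
    qed
  qed
qed

end
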